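(* Consider a uniform linear array with fixed antenna spacing $D\le\lambda/2$, where $\lambda$ is the wavelength. Let $\Phi\subset[0,\pi]$ be the angle-of-arrival (AoA) support of a user and $p(\theta)$ the probability density function of the AoA of that user. If $p(\theta)$ is uniformly bounded on $\Phi$, and $\Phi$ lies in a closed interval that does not include the directions parallel to the array, i.e. does not contain $0$ or $\pi$, then the spectral norm of the user's $M\times M$ channel covariance matrix $\mathbf R$ is uniformly bounded, i.e. there is a constant $\zeta$ such that $\|\mathbf R\|_2<\zeta$ for all $M\in\mathbb Z^+$.
   Context: Write $\mathrm i$ for the imaginary unit. For an $M$-antenna uniform linear array the steering vector $\mathbf a(\theta)\in\mathbb C^M$, $\theta\in[0,\pi]$, has $m$-th entry $e^{-\mathrm i2\pi\frac{(m-1)D}{\lambda}\cos\theta}$, $m=1,\dots,M$. The user's channel is $\mathbf h=\frac{\beta}{\sqrt P}\sum_{p=1}^P\mathbf a(\theta_p)e^{\mathrm i\varphi_p}$, where $\beta>0$ is a path-loss constant independent of $M$, $P$ is the number of paths, the angles $\theta_p$ are i.i.d. with density $p(\theta)$, and the $\varphi_p$ are i.i.d. random phases, independent of the angles, with $\mathbb E\,e^{\mathrm i\varphi_p}=0$. The covariance matrix is $\mathbf R=\mathbb E\{\mathbf h\mathbf h^H\}$, i.e. $\mathbf R(m,n)=\beta^2\int_0^\pi p(\theta)\,e^{\mathrm i2\pi\frac D\lambda(n-m)\cos\theta}\,d\theta$ for $1\le m,n\le M$. The AoA support $\Phi$ is the set with $p(\theta)>0$ for $\theta\in\Phi$ and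 $p(\theta)=0$ for $\theta\notin\Phi$. $\|\cdot\|_2$ is the spectral norm. *)

theory Defs
  imports "HOL-Probability.Probability" "Jordan_Normal_Form.Matrix"
begin

text \<open>
  The number of antennas varies inside the statement, so vectors and matrices are those of
  \<^theory>\<open>Jordan_Normal_Form.Matrix\<close>, whose indices start at 0: the factor \<open>m\<close> below
  is the \<open>m - 1\<close> of the usual 1-based notation.
\<close>

definition steering_vector :: "real \<Rightarrow> real \<Rightarrow> nat \<Rightarrow> real \<Rightarrow> complex Matrix.vec" where
  "steering_vector D wavelength M t =
     Matrix.vec M (\<lambda>m. exp (- (\<i> * of_real (2 * pi * (real m * D / wavelength) * cos t))))"

definition channel ::
    "real \<Rightarrow> real \<Rightarrow> real \<Rightarrow> nat \<Rightarrow> (nat \<Rightarrow> 'a \<Rightarrow> real) \<Rightarrow> (nat \<Rightarrow> 'a \<Rightarrow> real) \<Rightarrow> nat \<Rightarrow> 'a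
      \<Rightarrow> complex Matrix.vec" where
  "channel D wavelength \<beta> P \<theta> \<phi> M \<omega> =
     Matrix.vec M (\<lambda>m. of_real (\<beta> / sqrt (real P)) *
       (\<Sum>p = 1..P. vec_index (steering_vector D wavelength M (\<theta> p \<omega>)) m * exp (\<i> * of_real (\<phi> p \<omega>))))"

text \<open>The entrywise expectation of \<open>h h\<^sup>H\<close> for a random vector \<open>h\<close> in dimension \<open>M\<close>.\<close>

definition covariance_matrix :: "'a measure \<Rightarrow> nat \<Rightarrow> ('a \<Rightarrow> complex Matrix.vec) \<Rightarrow> complex mat" where
  "covariance_matrix \<Omega> M h =
     mat M M (\<lambda>(m, n). integral\<^sup>L \<Omega> (\<lambda>\<omega>. vec_index (h \<omega>) m * cnj (vec_index (h \<omega>) n)))"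

definition vec_l2_norm :: "complex Matrix.vec \<Rightarrow> real" where
  "vec_l2_norm v = L2_set (\<lambda>i. norm (vec_index v i)) {..<dim_vec v}"

text \<open>
  The operator norm induced by the Euclidean norms. The supremum is taken in the reals; it is
  over a set that is bounded (lemma \<open>bdd_above_spectral_norm\<close>) and, if \<open>A\<close> has at least one
  column, nonempty.
\<close>

definition spectral_norm :: "complex mat \<Rightarrow> real" where
  "spectral_norm A =
     (SUP x \<in> {x \<in> carrier_vec (dim_col A). vec_l2_norm x = 1}. vec_l2_norm (A *\<^sub>v x))"

lemma bdd_above_spectral_norm:
  "bdd_above ((\<lambda>x. vec_l2_norm (A *\<^sub>v x)) ` {x \<in> carrier_vec (dim_col A). vec_l2_norm x = 1})"
proof (rule bdd_aboveI2)
  fix x assume "x \<in> {x \<in> carrier_vec (dim_col A). vec_l2_norm x = 1}"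
  then have dim: "dim_vec x = dim_col A"
    and one: "L2_set (\<lambda>i. norm (vec_index x i)) {..<dim_col A} = 1"
    by (auto simp: vec_l2_norm_def)
  have le1: "norm (vec_index x j) \<le> 1" if "j < dim_col A" for j
    using member_le_L2_set[of "{..<dim_col A}" j "\<lambda>i. norm (vec_index x i)"] one that by simp
  have "vec_l2_norm (A *\<^sub>v x) \<le> (\<Sum>i<dim_row A. norm (vec_index (A *\<^sub>v x) i))"
    unfolding vec_l2_norm_def dim_mult_mat_vec by (rule L2_set_le_sum) simp
  also have "\<dots> \<le> (\<Sum>i<dim_row A. \<Sum>j<dim_col A. norm (A $$ (i, j)))"
  proof (rule sum_mono)
    fix i assume i: "i \<in> {..<dim_row A}"
    have "norm (vec_index (A *\<^sub>v x) i) = norm (\<Sum>j<dim_col A. A $$ (i, j) * vec_index x j)"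
      using i dim by (simp add: scalar_prod_def atLeast0LessThan)
    also have "\<dots> \<le> (\<Sum>j<dim_col A. norm (A $$ (i, j)))"
      by (rule sum_norm_le) (auto simp: norm_mult intro!: mult_left_le le1)
    finally show "norm (vec_index (A *\<^sub>v x) i) \<le> (\<Sum>j<dim_col A. norm (A $$ (i, j)))" .
  qed
  finally show "vec_l2_norm (A *\<^sub>v x) \<le> (\<Sum>i<dim_row A. \<Sum>j<dim_col A. norm (A $$ (i, j)))" .
qed

end

theory Submission
  imports Defs
begin

text \<open>
  Independence and \<open>\<bbbE> e\<^sup>i\<^sup>\<phi> = 0\<close> remove all cross terms between different paths, so with
  \<open>k = 2\<pi>D/\<lambda>\<close> and \<open>X\<^sub>x(v) = \<Sum>n. x\<^sub>n e\<^sup>i\<^sup>n\<^sup>v\<close> the sesquilinear form of the covariance matrix is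
  \<open>y\<^sup>H R x = \<beta>\<^sup>2 \<integral> f(t) cnj (X\<^sub>y(k cos t)) X\<^sub>x(k cos t) dt\<close>. Substituting \<open>v = k cos t\<close> turns the integrals
  of \<open>f(t) \<bar>X\<^sub>x(k cos t)\<bar>\<^sup>2\<close> into integrals against a bounded density on \<open>[-k, k]\<close>. Since
  \<open>D \<le> \<lambda>/2\<close> gives \<open>k \<le> \<pi>\<close>, Parseval's identity on \<open>[-\<pi>, \<pi>]\<close> bounds them independently of the
  dimension.
\<close>

section \<open>Parseval's identity for trigonometric polynomials\<close>

lemma has_integral_cis_int:
  fixes j :: int
  shows "((\<lambda>v. cis (of_int j * v)) has_integral (if j = 0 then of_real (2 * pi) else 0)) {-pi..pi}"
proof (cases "j = 0")
  case True
  then show ?thesis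
    using has_integral_const_real[of "1::complex" "-pi" pi] by (simp add: scaleR_conv_of_real)
next
  case False
  let ?F = "\<lambda>v::real. cis (of_int j * v) / (\<i> * of_int j)"
  have "((\<lambda>v. cis (of_int j * v)) has_integral (?F pi - ?F (-pi))) {-pi..pi}"
  proof (rule fundamental_theorem_of_calculus)
    fix x :: real
    show "(?F has_vector_derivative cis (of_int j * x)) (at x within {-pi..pi})"
      unfolding has_vector_derivative_def using False
      by (auto intro!: derivative_eq_intros simp: fun_eq_iff scaleR_conv_of_real field_simps)
  qed simp
  \<comment> \<open>The two arguments differ by \<open>2 * pi * j\<close>, a whole number of
    periods, so the primitive has equal values at both ends.\<close>
  moreover have "cis (of_int j * pi) = cis (of_int j * (-pi))"
    by (simp add: complex_eq_iff sin_integer_2pi mult.commute)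
  ultimately show ?thesis using False by simp
qed

text \<open>Expanding the square gives a double sum of terms with frequency \<open>n - m\<close>;
  over a full period only those with \<open>n = m\<close> have a nonzero integral.\<close>

lemma has_integral_norm_trig_poly_sq:
  fixes x :: "nat \<Rightarrow> complex"
  shows "((\<lambda>v. (norm (\<Sum>n<M. x n * cis (real n * v)))\<^sup>2) has_integral
           2 * pi * (\<Sum>n<M. (norm (x n))\<^sup>2)) {-pi..pi}"
proof -
  \<comment> \<open>The frequency is a difference of integers, since subtraction of naturals would
    cut off the negative frequencies.\<close>
  have expand: "of_real ((norm (\<Sum>n<M. x n * cis (real n * v)))\<^sup>2) =
      (\<Sum>n<M. \<Sum>m<M. x n * cnj (x m) * cis (of_int (int n - int m) * v))" for v
  proof -
    have "x n * cis (real n * v) * cnj (x m * cis (real m * v)) =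
        x n * cnj (x m) * cis (of_int (int n - int m) * v)" for n m
    proof -
      have "x n * cis (real n * v) * cnj (x m * cis (real m * v)) =
          x n * cnj (x m) * (cis (real n * v) * cis (- (real m * v)))"
        by (simp add: cis_cnj)
      then show ?thesis
        by (simp add: cis_mult left_diff_distrib)
    qed
    then show ?thesis
      unfolding complex_norm_square cnj_sum sum_product by (intro sum.cong refl)
  qed
  have "((\<lambda>v. \<Sum>n<M. \<Sum>m<M. x n * cnj (x m) * cis (of_int (int n - int m) * v)) has_integral
      (\<Sum>n<M. \<Sum>m<M. x n * cnj (x m) * (if int n - int m = 0 then of_real (2 * pi) else 0)))
      {-pi..pi}"
    by (intro has_integral_sum has_integral_mult_right has_integral_cis_int) auto
  also have "(\<Sum>n<M. \<Sum>m<M. x n * cnj (x m) * (if int n - int m = 0 then of_real (2 * pi) else 0)) =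
      (\<Sum>n<M. x n * cnj (x n) * of_real (2 * pi))"
    by (intro sum.cong refl) (simp add: if_distrib cong: if_cong)
  also have "\<dots> = of_real (2 * pi * (\<Sum>n<M. (norm (x n))\<^sup>2))"
    by (simp add: complex_norm_square[symmetric] sum_distrib_left mult.commute del: of_real_power)
  finally have "((\<lambda>v. of_real ((norm (\<Sum>n<M. x n * cis (real n * v)))\<^sup>2) :: complex) has_integral
      of_real (2 * pi * (\<Sum>n<M. (norm (x n))\<^sup>2))) {-pi..pi}"
    by (simp only: expand)
  from has_integral_linear[OF this bounded_linear_Re]
  show ?thesis by (simp add: o_def del: of_real_power of_real_mult of_real_sum)
qed

section \<open>Change of variable from the angle to \<open>k * cos t\<close>\<close>

lemma sin_ge_min_endpoints:
  assumes "0 \<le> a" "b \<le> pi" "t \<in> {a..b}"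
  shows "min (sin a) (sin b) \<le> sin t"
proof (cases "t \<le> pi / 2")
  case True
  then have "sin a \<le> sin t" using assms by (intro sin_monotone_2pi_le) auto
  then show ?thesis by simp
next
  case False
  \<comment> \<open>The reflection \<open>t \<mapsto> pi - t\<close> moves the second half of
    \<open>[0, pi]\<close> into the range where the sine increases, so the comparison is now with
    \<open>b\<close>.\<close>
  then have "sin (pi - b) \<le> sin (pi - t)" using assms by (intro sin_monotone_2pi_le) auto
  then show ?thesis by simp
qed

text \<open>
  The substitution \<open>v = k cos t\<close> has Jacobian \<open>k sin t\<close>, which the distance of the support from
  \<open>0\<close> and \<open>pi\<close> bounds away from zero.
\<close>

lemma integral_density_cos_le:
  fixes f G :: "real \<Rightarrow> real"
  assumes k: "0 < k" "k \<le> pi" and ab: "0 < a" "a \<le> b" "b < pi"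
    and f: "\<And>t. 0 \<le> f t" "\<And>t. f t \<le> B" "\<And>t. t \<notin> {a..b} \<Longrightarrow> f t = 0"
    and G: "continuous_on UNIV G" "\<And>v. 0 \<le> G v"
  shows "(\<integral>t. f t * G (k * cos t) \<partial>lborel) \<le>
           B / (k * min (sin a) (sin b)) * integral {-pi..pi} G"
proof -
  define s where "s = min (sin a) (sin b)"
  define g where "g t = k * sin t * G (k * cos t)" for t
  have s: "0 < s" unfolding s_def using ab by (simp add: sin_gt_zero)
  have B: "0 \<le> B" using f(1,2)[of 0] by linarith
  have cont: "continuous_on {a..b} g" unfolding g_def
    by (intro continuous_intros continuous_on_compose2[OF G(1)]) auto
  have g_nonneg: "0 \<le> g t" if "t \<in> {a..b}" for t
    unfolding g_def using k(1) G(2) ab that by (auto intro!: mult_nonneg_nonneg sin_ge_zero)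
  have gint: "set_integrable lborel {a..b} g"
    by (rule borel_integrable_atLeastAtMost'[OF cont])
  have le: "k * cos b \<le> k * cos a"
    using ab k by (intro mult_left_mono cos_monotone_0_pi_le) auto
  have abs_le: "\<bar>k * cos t\<bar> \<le> k" for t
    using k(1) mult_left_mono[OF abs_cos_le_one, of k t] by (simp add: abs_mult)
  have ran: "k * cos t \<in> {-pi..pi}" for t using abs_le[of t] k(2) by auto
  have "((\<lambda>t. (- (k * sin t)) *\<^sub>R G (k * cos t)) has_integral
      (integral {k * cos a..k * cos b} G - integral {k * cos b..k * cos a} G)) {a..b}"
    using ab ran
    by (intro has_integral_substitution_general[of "{}" _ _ _ "-pi" pi])
       (auto intro!: derivative_eq_intros continuous_intros continuous_on_subset[OF G(1)])
  \<comment> \<open>The cosine decreases, so this interval is empty or a single point; only the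
    integral with reversed orientation remains, and its minus sign matches that of the
    Jacobian.\<close>
  moreover have "integral {k * cos a..k * cos b} G = 0"
    using le by (cases "k * cos a = k * cos b") auto
  ultimately have "((\<lambda>t. - g t) has_integral - integral {k * cos b..k * cos a} G) {a..b}"
    by (simp add: g_def)
  from has_integral_neg[OF this] have "(g has_integral integral {k * cos b..k * cos a} G) {a..b}"
    by simp
  then have "integral {a..b} g = integral {k * cos b..k * cos a} G" by (rule integral_unique)
  \<comment> \<open>Here \<open>k \<le> pi\<close> matters: the range of \<open>k * cos t\<close>
    fits into one period, and enlarging it cannot decrease the integral of the nonnegative
    \<open>G\<close>.\<close>
  also have "\<dots> \<le> integral {-pi..pi} G"
    using ran[of a] ran[of b] G
    by (intro integral_subset_le integrable_continuous_real continuous_on_subset[OF G(1)]) auto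
  finally have sub: "integral {a..b} g \<le> integral {-pi..pi} G" .
  have "(\<integral>t. f t * G (k * cos t) \<partial>lborel) \<le> (\<integral>t. B / (k * s) * (indicator {a..b} t *\<^sub>R g t) \<partial>lborel)"
  \<comment> \<open>Only the dominating function has to be integrable: otherwise the left integral
    is 0 by convention, which is below a nonnegative right side.\<close>
  proof (rule integral_mono')
    show "integrable lborel (\<lambda>t. B / (k * s) * (indicator {a..b} t *\<^sub>R g t))"
      using gint unfolding set_integrable_def by (intro integrable_mult_right)
    show "0 \<le> B / (k * s) * (indicator {a..b} t *\<^sub>R g t)" for t
      using B k(1) s g_nonneg[of t] by (auto simp: indicator_def)
    show "f t * G (k * cos t) \<le> B / (k * s) * (indicator {a..b} t *\<^sub>R g t)" for t
    proof (cases "t \<in> {a..b}")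
      case True
      then have st: "s \<le> sin t" unfolding s_def using ab by (intro sin_ge_min_endpoints) auto
      have "f t * G (k * cos t) \<le> B * G (k * cos t)" using f(2) G(2) by (intro mult_right_mono)
      \<comment> \<open>The factor \<open>sin t / s\<close> is at least 1; inserting it supplies the
        Jacobian at the cost of \<open>1 / s\<close>.\<close>
      also have "\<dots> \<le> B * G (k * cos t) * (sin t / s)"
        using st s B G(2) mult_left_mono[of 1 "sin t / s" "B * G (k * cos t)"] by simp
      also have "\<dots> = B / (k * s) * g t" using k(1) s by (simp add: g_def)
      finally show ?thesis using True by simp
    qed (simp add: f(3))
  qed
  also have "\<dots> = B / (k * s) * integral {a..b} g"
    using set_borel_integral_eq_integral(2)[OF gint] by (simp add: set_lebesgue_integral_def)
  also have "\<dots> \<le> B / (k * s) * integral {-pi..pi} G"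
    using sub B k(1) s by (intro mult_left_mono) auto
  finally show ?thesis by (simp add: s_def)
qed

text \<open>By duality, the length of \<open>A x\<close> is the value of the sesquilinear form at
  \<open>x\<close> and the unit vector in the direction of \<open>A x\<close>. Hence a bound for the
  form on unit vectors bounds the norm.\<close>

lemma spectral_norm_le:
  assumes col: "0 < dim_col A" and C: "0 \<le> C"
    and bound: "\<And>x y. (\<Sum>j<dim_col A. (norm (x j))\<^sup>2) = 1 \<Longrightarrow> (\<Sum>i<dim_row A. (norm (y i))\<^sup>2) = 1 \<Longrightarrow>
      norm (\<Sum>i<dim_row A. \<Sum>j<dim_col A. cnj (y i) * A $$ (i, j) * x j) \<le> C"
  shows "spectral_norm A \<le> C"
  unfolding spectral_norm_def
proof (rule cSUP_least)
  \<comment> \<open>A supremum of reals is bounded this way only over a nonempty set; a column of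
    \<open>A\<close> provides a unit vector.\<close>
  let ?e = "unit_vec (dim_col A) 0 :: complex Matrix.vec"
  have "(\<Sum>i<dim_col A. (norm (vec_index ?e i))\<^sup>2) = (\<Sum>i<dim_col A. if i = 0 then 1 else 0)"
    by (intro sum.cong) (auto simp: unit_vec_def)
  then have "vec_l2_norm ?e = 1"
    using col by (simp add: vec_l2_norm_def L2_set_def)
  then show "{x \<in> carrier_vec (dim_col A). vec_l2_norm x = 1} \<noteq> {}"
    by (auto intro: unit_vec_carrier)
next
  fix x assume "x \<in> {x \<in> carrier_vec (dim_col A). vec_l2_norm x = 1}"
  then have dim: "dim_vec x = dim_col A" and one: "(\<Sum>j<dim_col A. (norm (vec_index x j))\<^sup>2) = 1"
    by (auto simp: vec_l2_norm_def L2_set_def)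
  define z where "z i = vec_index (A *\<^sub>v x) i" for i
  define N where "N = vec_l2_norm (A *\<^sub>v x)"
  have N2: "(\<Sum>i<dim_row A. (norm (z i))\<^sup>2) = N\<^sup>2"
    by (simp add: N_def z_def vec_l2_norm_def L2_set_def sum_nonneg)
  have N0: "0 \<le> N" by (simp add: N_def vec_l2_norm_def)
  have z: "z i = (\<Sum>j<dim_col A. A $$ (i, j) * vec_index x j)" if "i < dim_row A" for i
    using that dim by (simp add: z_def scalar_prod_def atLeast0LessThan)
  show "vec_l2_norm (A *\<^sub>v x) \<le> C"
  proof (cases "N = 0")
    case False
    \<comment> \<open>Normalising \<open>A x\<close> makes the form equal to
      \<open>N\<^sup>2 / N = N\<close>. The remaining case \<open>N = 0\<close> is just
      \<open>0 \<le> C\<close>.\<close>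
    define y where "y i = z i / of_real N" for i
    have "(\<Sum>i<dim_row A. (norm (y i))\<^sup>2) = 1"
      using N2 False by (simp add: y_def norm_divide power_divide sum_divide_distrib[symmetric])
    from bound[OF one this]
    have "norm (\<Sum>i<dim_row A. \<Sum>j<dim_col A. cnj (y i) * A $$ (i, j) * vec_index x j) \<le> C" .
    also have "(\<Sum>i<dim_row A. \<Sum>j<dim_col A. cnj (y i) * A $$ (i, j) * vec_index x j) =
        (\<Sum>i<dim_row A. cnj (y i) * z i)"
      by (intro sum.cong refl) (simp add: z sum_distrib_left mult.assoc)
    also have "\<dots> = (\<Sum>i<dim_row A. of_real ((norm (z i))\<^sup>2)) / of_real N"
      unfolding complex_norm_square y_def by (simp add: sum_divide_distrib mult.commute)
    also have "\<dots> = of_real N"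
      using False unfolding of_real_sum[symmetric] N2 by (simp add: power2_eq_square)
    finally show ?thesis using N0 by (simp add: N_def)
  qed (use C N_def in auto)
qed


section \<open>Covariance of the multipath channel\<close>

lemma vec_index_steering_vector:
  assumes "m < M"
  shows "vec_index (steering_vector D wavelength M t) m =
           cis (- (real m * (2 * pi * D / wavelength * cos t)))"
  using assms by (simp add: steering_vector_def cis_conv_exp field_simps)

lemma borel_measurable_cis [measurable]:
  "g \<in> borel_measurable N \<Longrightarrow> (\<lambda>x. cis (g x)) \<in> borel_measurable N"
  by (rule measurable_compose[where g = cis])
     (auto intro!: borel_measurable_continuous_onI continuous_on_cis continuous_on_id)

text \<open>Both factors are bounded functions of independent phases, so the expectation of the
  product splits, and the factor belonging to \<open>p\<close> has mean zero.\<close>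

lemma (in prob_space) expectation_indep_phase_factors:
  assumes indep: "indep_vars (\<lambda>_. borel) \<phi> I" and pq: "p \<in> I" "q \<in> I" "p \<noteq> q"
    and mean: "expectation (\<lambda>\<omega>. cis (\<phi> p \<omega>)) = 0"
  shows "expectation (\<lambda>\<omega>. cis (\<phi> p \<omega>) * cnj (cis (\<phi> q \<omega>))) = 0"
proof -
  \<comment> \<open>The conjugate is encoded as a negated phase, which turns the expression into a
    product over the family indexed by \<open>{p, q}\<close>.\<close>
  define X where "X i \<omega> = (if i = p then cis (\<phi> i \<omega>) else cis (- \<phi> i \<omega>))" for i \<omega>
  have "indep_vars (\<lambda>_. borel) \<phi> {p, q}"
    using pq by (intro indep_vars_subset[OF indep]) auto
  then have X: "indep_vars (\<lambda>_. borel) X {p, q}"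
    unfolding X_def[abs_def]
    by (rule indep_vars_compose2[where Y = "\<lambda>i u. if i = p then cis u else cis (- u)"]) measurable
  have int: "integrable M (X i)" if "i \<in> {p, q}" for i
  proof (rule integrable_const_bound)
    show "AE \<omega> in M. norm (X i \<omega>) \<le> 1" by (simp add: X_def)
    show "X i \<in> borel_measurable M" using X that by (auto simp: indep_vars_def)
  qed
  have "expectation (\<lambda>\<omega>. \<Prod>i\<in>{p, q}. X i \<omega>) = (\<Prod>i\<in>{p, q}. expectation (X i))"
    by (rule indep_vars_lebesgue_integral) (use X int in auto)
  then show ?thesis using pq mean by (simp add: X_def[abs_def] cis_cnj)
qed

text \<open>The product of two channel entries is a double sum over pairs of paths, each summand an
  angle part times a phase part. Independence splits the expectation, and that of the phase part is
  1 for equal paths and 0 for distinct ones, so a single sum is left.\<close>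

lemma (in prob_space) covariance_channel_entry:
  fixes \<theta> \<phi> :: "nat \<Rightarrow> 'a \<Rightarrow> real" and D wavelength :: real
  defines "e n t \<equiv> cis (- (real n * (2 * pi * D / wavelength * cos t)))"
  assumes \<theta>: "\<And>p. p \<in> {1..P} \<Longrightarrow> random_variable borel (\<theta> p)"
    and \<phi>: "indep_vars (\<lambda>_. borel) \<phi> {1..P}"
    and mean: "\<And>p. p \<in> {1..P} \<Longrightarrow> expectation (\<lambda>\<omega>. cis (\<phi> p \<omega>)) = 0"
    and indep: "indep_var
         (Pi\<^sub>M {1..P} (\<lambda>_. borel)) (\<lambda>\<omega>. \<lambda>p\<in>{1..P}. \<theta> p \<omega>)
         (Pi\<^sub>M {1..P} (\<lambda>_. borel)) (\<lambda>\<omega>. \<lambda>p\<in>{1..P}. \<phi> p \<omega>)"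
    and mn: "m < N" "n < N"
  shows "covariance_matrix M N (channel D wavelength \<beta> P \<theta> \<phi> N) $$ (m, n) =
           of_real (\<beta>\<^sup>2 / real P) * (\<Sum>p = 1..P. expectation (\<lambda>\<omega>. e m (\<theta> p \<omega>) * cnj (e n (\<theta> p \<omega>))))"
proof -
  have \<phi>m: "random_variable borel (\<phi> p)" if "p \<in> {1..P}" for p
    using \<phi> that by (auto simp: indep_vars_def)
  note [measurable] = \<theta> \<phi>m
  define T where "T p q \<omega> = e m (\<theta> p \<omega>) * cnj (e n (\<theta> q \<omega>))" for p q \<omega>
  define F where "F p q \<omega> = cis (\<phi> p \<omega>) * cnj (cis (\<phi> q \<omega>))" for p q \<omega>
  have e_meas [measurable]: "e j \<in> borel_measurable borel" for j
    unfolding e_def by measurable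
  have T_int: "integrable M (T p q)" if "p \<in> {1..P}" "q \<in> {1..P}" for p q
    unfolding T_def using that
    by (intro integrable_const_bound[of _ 1]) (auto simp: norm_mult e_def cis_cnj)
  have F_int: "integrable M (F p q)" if "p \<in> {1..P}" "q \<in> {1..P}" for p q
    unfolding F_def using that
    by (intro integrable_const_bound[of _ 1]) (auto simp: norm_mult cis_cnj)
  have cross: "integrable M (\<lambda>\<omega>. T p q \<omega> * F p q \<omega>) \<and>
      expectation (\<lambda>\<omega>. T p q \<omega> * F p q \<omega>) = expectation (T p q) * expectation (F p q)"
    if "p \<in> {1..P}" "q \<in> {1..P}" for p q
  proof -
    \<comment> \<open>Independence is given for the tuple of all angles against the tuple of all
      phases; \<open>T p q\<close> and \<open>F p q\<close> are measurable images of one tuple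
      each.\<close>
    have "indep_var borel ((\<lambda>v. e m (v p) * cnj (e n (v q))) \<circ> (\<lambda>\<omega>. \<lambda>p\<in>{1..P}. \<theta> p \<omega>))
        borel ((\<lambda>v. cis (v p) * cnj (cis (v q))) \<circ> (\<lambda>\<omega>. \<lambda>p\<in>{1..P}. \<phi> p \<omega>))"
      by (rule indep_var_compose[OF indep]; use that in \<open>simp only: cis_cnj e_def; measurable\<close>)
    then have "indep_var borel (T p q) borel (F p q)"
      using that by (simp add: o_def T_def[abs_def] F_def[abs_def])
    then show ?thesis
      using indep_var_lebesgue_integral[of "T p q" "F p q"] indep_var_integrable[of "T p q" "F p q"]
        T_int F_int that by auto
  qed
  have F: "expectation (F p q) = (if p = q then 1 else 0)" if "p \<in> {1..P}" "q \<in> {1..P}" for p q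
  proof (cases "p = q")
    case True
    then show ?thesis by (simp add: F_def[abs_def] cis_cnj cis_mult prob_space)
  next
    case False
    then show ?thesis
      using expectation_indep_phase_factors[OF \<phi> that False mean[OF that(1)]] by (simp add: F_def[abs_def])
  qed
  have prod: "vec_index (channel D wavelength \<beta> P \<theta> \<phi> N \<omega>) m *
        cnj (vec_index (channel D wavelength \<beta> P \<theta> \<phi> N \<omega>) n) =
      of_real (\<beta>\<^sup>2 / real P) * (\<Sum>p = 1..P. \<Sum>q = 1..P. T p q \<omega> * F p q \<omega>)" for \<omega>
  proof -
    have c: "vec_index (channel D wavelength \<beta> P \<theta> \<phi> N \<omega>) j =
        of_real (\<beta> / sqrt (real P)) * (\<Sum>p = 1..P. e j (\<theta> p \<omega>) * cis (\<phi> p \<omega>))" if "j < N" for j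
      using that by (simp add: channel_def vec_index_steering_vector e_def cis_conv_exp)
    have sq: "of_real (\<beta> / sqrt (real P)) * of_real (\<beta> / sqrt (real P)) = (of_real (\<beta>\<^sup>2 / real P) :: complex)"
      unfolding of_real_mult[symmetric] by (simp add: power2_eq_square)
    have "vec_index (channel D wavelength \<beta> P \<theta> \<phi> N \<omega>) m *
        cnj (vec_index (channel D wavelength \<beta> P \<theta> \<phi> N \<omega>) n) =
        of_real (\<beta> / sqrt (real P)) * of_real (\<beta> / sqrt (real P)) *
          ((\<Sum>p = 1..P. e m (\<theta> p \<omega>) * cis (\<phi> p \<omega>)) * (\<Sum>q = 1..P. cnj (e n (\<theta> q \<omega>) * cis (\<phi> q \<omega>))))"
      unfolding c[OF mn(1)] c[OF mn(2)] complex_cnj_mult cnj_sum complex_cnj_complex_of_real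
      by (rule semiring_normalization_rules(13))
    also have "\<dots> = of_real (\<beta>\<^sup>2 / real P) * (\<Sum>p = 1..P. \<Sum>q = 1..P. T p q \<omega> * F p q \<omega>)"
      unfolding sq sum_product by (simp add: T_def F_def mult_ac)
    finally show ?thesis .
  qed
  have "covariance_matrix M N (channel D wavelength \<beta> P \<theta> \<phi> N) $$ (m, n) =
      of_real (\<beta>\<^sup>2 / real P) * expectation (\<lambda>\<omega>. \<Sum>p = 1..P. \<Sum>q = 1..P. T p q \<omega> * F p q \<omega>)"
    using mn by (simp add: covariance_matrix_def prod)
  also have "expectation (\<lambda>\<omega>. \<Sum>p = 1..P. \<Sum>q = 1..P. T p q \<omega> * F p q \<omega>) =
      (\<Sum>p = 1..P. \<Sum>q = 1..P. expectation (T p q) * expectation (F p q))"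
    by (simp add: Bochner_Integration.integral_sum Bochner_Integration.integrable_sum cross
        del: atLeastAtMost_iff)
  also have "\<dots> = (\<Sum>p = 1..P. expectation (T p p))"
    by (intro sum.cong refl) (simp add: F if_distrib cong: if_cong)
  finally show ?thesis by (simp add: T_def[abs_def])
qed

text \<open>The sesquilinear form is \<open>\<beta>\<^sup>2\<close> times an average over the paths
  of mixed second moments of \<open>X y\<close> and \<open>X x\<close>. Each is bounded by the same
  constant, so neither \<open>N\<close> nor \<open>P\<close> enters the bound.\<close>

lemma (in prob_space) covariance_channel_spectral_norm_le:
  fixes \<theta> \<phi> :: "nat \<Rightarrow> 'a \<Rightarrow> real" and f :: "real \<Rightarrow> real" and D wavelength :: real
  defines "k \<equiv> 2 * pi * D / wavelength"
  assumes k: "0 < k" "k \<le> pi" and P: "1 \<le> P" and N: "1 \<le> N"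
    and \<phi>: "indep_vars (\<lambda>_. borel) \<phi> {1..P}"
    and mean: "\<And>p. p \<in> {1..P} \<Longrightarrow> expectation (\<lambda>\<omega>. cis (\<phi> p \<omega>)) = 0"
    and indep: "indep_var
         (Pi\<^sub>M {1..P} (\<lambda>_. borel)) (\<lambda>\<omega>. \<lambda>p\<in>{1..P}. \<theta> p \<omega>)
         (Pi\<^sub>M {1..P} (\<lambda>_. borel)) (\<lambda>\<omega>. \<lambda>p\<in>{1..P}. \<phi> p \<omega>)"
    and dens: "\<And>p. p \<in> {1..P} \<Longrightarrow> distributed M lborel (\<theta> p) (\<lambda>t. ennreal (f t))"
    and ab: "0 < a" "a \<le> b" "b < pi"
    and f: "\<And>t. 0 \<le> f t" "\<And>t. f t \<le> B" "\<And>t. t \<notin> {a..b} \<Longrightarrow> f t = 0"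
  shows "spectral_norm (covariance_matrix M N (channel D wavelength \<beta> P \<theta> \<phi> N)) \<le>
           \<beta>\<^sup>2 * (B / (k * min (sin a) (sin b)) * (2 * pi))"
    (is "spectral_norm ?R \<le> \<beta>\<^sup>2 * ?K")
proof -
  have \<theta> [measurable]: "random_variable borel (\<theta> p)" if "p \<in> {1..P}" for p
    using distributed_measurable[OF dens[OF that]] by simp
  have B: "0 \<le> B" using f(1,2)[of 0] by linarith
  have K: "0 \<le> ?K" using B k(1) ab by (auto simp: min_def sin_gt_zero intro!: divide_nonneg_nonneg mult_nonneg_nonneg sin_ge_zero)
  have dim: "dim_row ?R = N" "dim_col ?R = N" by (simp_all add: covariance_matrix_def)
  define X where "X x v = (\<Sum>n<N. x n * cis (real n * v))" for x :: "nat \<Rightarrow> complex" and v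
  have X_cont: "continuous_on UNIV (X x)" for x
    unfolding X_def by (intro continuous_intros)
  have X_meas [measurable]: "X x \<in> borel_measurable borel" for x
    by (rule borel_measurable_continuous_onI[OF X_cont])
  have X_le: "norm (X x v) \<le> (\<Sum>n<N. norm (x n))" for x v
    unfolding X_def by (rule order_trans[OF norm_sum]) (simp add: norm_mult)
  have X_sq_int: "integrable M (\<lambda>\<omega>. (norm (X x (k * cos (\<theta> p \<omega>))))\<^sup>2)" if "p \<in> {1..P}" for x p
    using that X_le[of x]
    by (intro integrable_const_bound[of _ "(\<Sum>n<N. norm (x n))\<^sup>2"]) (auto intro!: power_mono)
  have X_sq: "expectation (\<lambda>\<omega>. (norm (X x (k * cos (\<theta> p \<omega>))))\<^sup>2) \<le> ?K"
    if p: "p \<in> {1..P}" and one: "(\<Sum>n<N. (norm (x n))\<^sup>2) = 1" for x p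
  proof -
    have "expectation (\<lambda>\<omega>. (norm (X x (k * cos (\<theta> p \<omega>))))\<^sup>2) =
        (\<integral>t. f t * (norm (X x (k * cos t)))\<^sup>2 \<partial>lborel)"
      by (rule distributed_integral[OF dens[OF p], symmetric]) (use f(1) in auto)
    also have "\<dots> \<le> B / (k * min (sin a) (sin b)) * integral {-pi..pi} (\<lambda>v. (norm (X x v))\<^sup>2)"
      by (rule integral_density_cos_le[OF k ab f]) (auto intro!: continuous_intros X_cont)
    \<comment> \<open>The dimension drops out here: for coefficients of norm 1 the Parseval integral
      does not depend on \<open>N\<close>.\<close>
    also have "integral {-pi..pi} (\<lambda>v. (norm (X x v))\<^sup>2) = 2 * pi"
      unfolding X_def using has_integral_norm_trig_poly_sq[of x N] one by (simp add: integral_unique)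
    finally show ?thesis .
  qed
  have path: "norm (expectation (\<lambda>\<omega>. cnj (X y (k * cos (\<theta> p \<omega>))) * X x (k * cos (\<theta> p \<omega>)))) \<le> ?K"
    if p: "p \<in> {1..P}" and x: "(\<Sum>n<N. (norm (x n))\<^sup>2) = 1" and y: "(\<Sum>n<N. (norm (y n))\<^sup>2) = 1" for x y p
  proof -
    let ?x = "\<lambda>\<omega>. (norm (X x (k * cos (\<theta> p \<omega>))))\<^sup>2" and ?y = "\<lambda>\<omega>. (norm (X y (k * cos (\<theta> p \<omega>))))\<^sup>2"
    have int: "integrable M (\<lambda>\<omega>. (?y \<omega> + ?x \<omega>) / 2)" using X_sq_int[OF p] by simp
    have "norm (expectation (\<lambda>\<omega>. cnj (X y (k * cos (\<theta> p \<omega>))) * X x (k * cos (\<theta> p \<omega>)))) \<le>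
        expectation (\<lambda>\<omega>. norm (cnj (X y (k * cos (\<theta> p \<omega>))) * X x (k * cos (\<theta> p \<omega>))))"
      by (rule integral_norm_bound)
    \<comment> \<open>Both second moments obey the same bound, so
      \<open>u * v \<le> (u\<^sup>2 + v\<^sup>2) / 2\<close> loses nothing against
      Cauchy-Schwarz.\<close>
    also have "\<dots> \<le> expectation (\<lambda>\<omega>. (?y \<omega> + ?x \<omega>) / 2)"
    proof (rule integral_mono'[OF int])
      fix \<omega>
      show "norm (cnj (X y (k * cos (\<theta> p \<omega>))) * X x (k * cos (\<theta> p \<omega>))) \<le> (?y \<omega> + ?x \<omega>) / 2"
        using sum_squares_bound[of "norm (X y (k * cos (\<theta> p \<omega>)))" "norm (X x (k * cos (\<theta> p \<omega>)))"]
        by (simp add: norm_mult)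
    qed simp
    also have "\<dots> = (expectation ?y + expectation ?x) / 2"
      using X_sq_int[OF p] by simp
    also have "\<dots> \<le> ?K" using add_mono[OF X_sq[OF p y] X_sq[OF p x]] by (simp only: divide_le_eq_numeral1 mult_2_right)
    finally show ?thesis .
  qed
  define e where "e n t = cis (- (real n * (k * cos t)))" for n t
  have e_meas [measurable]: "e j \<in> borel_measurable borel" for j
    unfolding e_def by measurable
  have e_int: "integrable M (\<lambda>\<omega>. e m (\<theta> p \<omega>) * cnj (e n (\<theta> p \<omega>)))" if "p \<in> {1..P}" for m n p
    using that by (intro integrable_const_bound[of _ 1]) (auto simp: norm_mult e_def cis_cnj)
  show ?thesis
  proof (rule spectral_norm_le[where A = ?R, unfolded dim])
    fix x y :: "nat \<Rightarrow> complex"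
    assume x: "(\<Sum>j<N. (norm (x j))\<^sup>2) = 1" and y: "(\<Sum>i<N. (norm (y i))\<^sup>2) = 1"
    \<comment> \<open>The steering vector has a negative exponent and \<open>X\<close> a positive
      one, so \<open>cnj (X y)\<close> yields \<open>e m\<close> and \<open>X x\<close> yields
      \<open>cnj (e n)\<close>.\<close>
    have split: "cnj (X y (k * cos t)) * X x (k * cos t) =
        (\<Sum>m<N. \<Sum>n<N. cnj (y m) * x n * (e m t * cnj (e n t)))" for t
      unfolding X_def cnj_sum sum_product by (simp add: e_def cis_cnj mult_ac)
    have path_eq: "expectation (\<lambda>\<omega>. cnj (X y (k * cos (\<theta> p \<omega>))) * X x (k * cos (\<theta> p \<omega>))) =
        (\<Sum>m<N. \<Sum>n<N. cnj (y m) * x n * expectation (\<lambda>\<omega>. e m (\<theta> p \<omega>) * cnj (e n (\<theta> p \<omega>))))"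
      if "p \<in> {1..P}" for p
      unfolding split using e_int[OF that]
      by (simp add: Bochner_Integration.integral_sum Bochner_Integration.integrable_sum)
    have "(\<Sum>m<N. \<Sum>n<N. cnj (y m) * ?R $$ (m, n) * x n) =
        (\<Sum>m<N. \<Sum>n<N. \<Sum>p = 1..P. of_real (\<beta>\<^sup>2 / real P) *
          (cnj (y m) * x n * expectation (\<lambda>\<omega>. e m (\<theta> p \<omega>) * cnj (e n (\<theta> p \<omega>)))))"
    proof (intro sum.cong refl)
      fix m n assume "m \<in> {..<N}" "n \<in> {..<N}"
      then have mn: "m < N" "n < N" by auto
      have entry: "?R $$ (m, n) = of_real (\<beta>\<^sup>2 / real P) *
          (\<Sum>p = 1..P. expectation (\<lambda>\<omega>. e m (\<theta> p \<omega>) * cnj (e n (\<theta> p \<omega>))))"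
        unfolding e_def k_def by (rule covariance_channel_entry[OF \<theta> \<phi> mean indep mn])
      show "cnj (y m) * ?R $$ (m, n) * x n = (\<Sum>p = 1..P. of_real (\<beta>\<^sup>2 / real P) *
          (cnj (y m) * x n * expectation (\<lambda>\<omega>. e m (\<theta> p \<omega>) * cnj (e n (\<theta> p \<omega>)))))"
        unfolding entry by (simp only: sum_distrib_left sum_distrib_right mult_ac)
    qed
    \<comment> \<open>Two exchanges bring the sum over paths outermost, so that the sums over
      antennas form one expectation per path.\<close>
    also have "\<dots> = (\<Sum>m<N. \<Sum>p = 1..P. \<Sum>n<N. of_real (\<beta>\<^sup>2 / real P) *
          (cnj (y m) * x n * expectation (\<lambda>\<omega>. e m (\<theta> p \<omega>) * cnj (e n (\<theta> p \<omega>)))))"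
      by (intro sum.cong refl sum.swap)
    also have "\<dots> = (\<Sum>p = 1..P. \<Sum>m<N. \<Sum>n<N. of_real (\<beta>\<^sup>2 / real P) *
          (cnj (y m) * x n * expectation (\<lambda>\<omega>. e m (\<theta> p \<omega>) * cnj (e n (\<theta> p \<omega>)))))"
      by (rule sum.swap)
    also have "\<dots> = of_real (\<beta>\<^sup>2 / real P) *
        (\<Sum>p = 1..P. expectation (\<lambda>\<omega>. cnj (X y (k * cos (\<theta> p \<omega>))) * X x (k * cos (\<theta> p \<omega>))))"
      by (simp only: path_eq sum_distrib_left cong: sum.cong)
    also have "norm \<dots> \<le> \<beta>\<^sup>2 / real P * (\<Sum>p = 1..P. ?K)"
      unfolding norm_mult norm_of_real by (intro mult_mono sum_norm_le path x y) (auto intro: sum_nonneg K)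
    also have "\<dots> = \<beta>\<^sup>2 * ?K" using P by simp
    finally show "norm (\<Sum>m<N. \<Sum>n<N. cnj (y m) * ?R $$ (m, n) * x n) \<le> \<beta>\<^sup>2 * ?K" .
  next
    show "0 < N" using N by simp
    show "0 \<le> \<beta>\<^sup>2 * ?K" by (intro mult_nonneg_nonneg zero_le_power2 K)
  qed
qed

theorem proposition1:
  fixes \<Omega> :: "'a measure"
    and D wavelength \<beta> a b :: real
    and P :: nat
    and \<theta> \<phi> :: "nat \<Rightarrow> 'a \<Rightarrow> real"
    and f :: "real \<Rightarrow> real"
    and \<Phi> :: "real set"
  assumes spacing: "0 < D" "D \<le> wavelength / 2"
    and path_loss: "0 < \<beta>"
    and paths: "1 \<le> P"
    and prob: "prob_space \<Omega>"
    and angles_indep: "prob_space.indep_vars \<Omega> (\<lambda>_. borel) \<theta> {1..P}"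
    and angles_density: "\<forall>p\<in>{1..P}. distributed \<Omega> lborel (\<theta> p) (\<lambda>t. ennreal (f t))"
    and phases_indep: "prob_space.indep_vars \<Omega> (\<lambda>_. borel) \<phi> {1..P}"
    and phases_ident: "\<forall>p\<in>{1..P}. \<forall>q\<in>{1..P}. distr \<Omega> borel (\<phi> p) = distr \<Omega> borel (\<phi> q)"
    and phases_mean: "\<forall>p\<in>{1..P}. integral\<^sup>L \<Omega> (\<lambda>\<omega>. exp (\<i> * of_real (\<phi> p \<omega>))) = 0"
    and angles_phases_indep:
      "prob_space.indep_var \<Omega>
         (Pi\<^sub>M {1..P} (\<lambda>_. borel)) (\<lambda>\<omega>. \<lambda>p\<in>{1..P}. \<theta> p \<omega>)
         (Pi\<^sub>M {1..P} (\<lambda>_. borel)) (\<lambda>\<omega>. \<lambda>p\<in>{1..P}. \<phi> p \<omega>)"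
    and support: "\<Phi> \<subseteq> {0..pi}" "\<forall>t\<in>\<Phi>. 0 < f t" "\<forall>t. t \<notin> \<Phi> \<longrightarrow> f t = 0"
    and density_bounded: "bounded (f ` \<Phi>)"
    and support_interval: "\<Phi> \<subseteq> {a..b}" "0 \<notin> {a..b}" "pi \<notin> {a..b}"
  shows "\<exists>\<zeta>::real. \<forall>M\<ge>1.
           spectral_norm (covariance_matrix \<Omega> M (channel D wavelength \<beta> P \<theta> \<phi> M)) < \<zeta>"
proof -
  interpret prob_space \<Omega> by (rule prob)
  have wavelength: "0 < wavelength" using spacing by linarith
  have k: "0 < 2 * pi * D / wavelength" "2 * pi * D / wavelength \<le> pi"
    using spacing wavelength by (auto simp: field_simps)
  \<comment> \<open>For nonempty \<open>\<Phi>\<close>, the interval \<open>{a..b}\<close> meets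
    \<open>[0, pi]\<close> and omits both of its ends, hence lies strictly inside. For empty
    \<open>\<Phi>\<close> it may be empty or lie elsewhere, so \<open>[1, 1]\<close> replaces
    it.\<close>
  obtain a' b' where ab: "0 < a'" "a' \<le> b'" "b' < pi" "\<Phi> \<subseteq> {a'..b'}"
  proof (cases "\<Phi> = {}")
    case True
    then show ?thesis using pi_gt3 by (intro that[of 1 1]) auto
  next
    case False
    then obtain t where "t \<in> \<Phi>" by blast
    then have "t \<in> {0..pi}" "t \<in> {a..b}" using support support_interval by blast+
    then show ?thesis using support_interval by (intro that[of a b]) auto
  qed
  have f_nonneg: "0 \<le> f t" for t
    using support(2,3) by (cases "t \<in> \<Phi>") (auto intro: less_imp_le)
  obtain B where "\<forall>t\<in>\<Phi>. norm (f t) \<le> B" using density_bounded by (auto simp: bounded_iff)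
  \<comment> \<open>\<open>B\<close> bounds the density on \<open>\<Phi>\<close> only, and may be
    negative if \<open>\<Phi>\<close> is empty; the maximum with 0 also covers the points
    outside.\<close>
  then have f_le: "f t \<le> max B 0" for t
    using support(3) by (cases "t \<in> \<Phi>") force+
  have f_zero: "f t = 0" if "t \<notin> {a'..b'}" for t using support(3) ab(4) that by blast
  have mean: "expectation (\<lambda>\<omega>. cis (\<phi> p \<omega>)) = 0" if "p \<in> {1..P}" for p
    using phases_mean that by (simp add: cis_conv_exp)
  have dens: "distributed \<Omega> lborel (\<theta> p) (\<lambda>t. ennreal (f t))" if "p \<in> {1..P}" for p
    using angles_density that by blast
  note bound = covariance_channel_spectral_norm_le[OF k paths _ phases_indep mean angles_phases_indep
      dens ab(1-3) f_nonneg f_le f_zero, of _ \<beta>]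
  show ?thesis
    \<comment> \<open>The inequality is strict, so \<open>\<zeta>\<close> is the bound plus 1;
      unification can find it because the bound does not contain \<open>M\<close>.\<close>
    by (rule exI, intro allI impI, rule le_less_trans[OF bound less_add_one])
qed

end
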